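(* Let $H$ be an infinite-dimensional complex Hilbert space and let $T\in\mathcal{AN}(H)$ be a $\ast$-paranormal operator. If $\dim N(T)=\dim N(T^* )$, then $T$ is normal.
   Context: $\mathcal{B}(H)$ denotes the bounded linear operators on $H$, and $N(T)$ the null space of $T$. An operator $T\in\mathcal{B}(H)$ is $\ast$-paranormal if $\|T^*x\|^2\le\|T^2x\|\,\|x\|$ for every $x\in H$. An operator $T$ is norm attaining if $\|Tx\|=\|T\|\|x\|$ for some nonzero $x$ in its domain space; $T\in\mathcal{B}(H)$ is absolutely norm attaining if $T|_M$ is norm attaining for every nonzero closed subspace $M\subseteq H$. $\mathcal{AN}(H)$ is the set of absolutely norm attaining operators in $\mathcal{B}(H)$. *)

theory Defs
  imports "HOL-Analysis.Analysis"
begin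

section \<open>Complex Hilbert spaces\<close>

text \<open>
  A complex inner product space carries the real inner product \<open>Re \<langle>x, y\<rangle>\<close>, which induces the same
  norm.  The class below is therefore set up as an extension of \<^class>\<open>real_inner\<close>, whose \<open>inner\<close> is
  required to be that real part; positive definiteness of \<open>cinner\<close> and the formula
  \<open>norm x = sqrt \<langle>x, x\<rangle>\<close> are inherited from it (lemma \<open>norm_eq_sqrt_cinner\<close>).
  The complex inner product is linear in the first argument.
\<close>

class complex_inner = real_inner +
  fixes scaleC :: "complex \<Rightarrow> 'a \<Rightarrow> 'a"  (infixr \<open>*\<^sub>C\<close> 75)
    and cinner :: "'a \<Rightarrow> 'a \<Rightarrow> complex"
  assumes scaleC_add_right: "c *\<^sub>C (x + y) = c *\<^sub>C x + c *\<^sub>C y"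
    and scaleC_add_left: "(c + d) *\<^sub>C x = c *\<^sub>C x + d *\<^sub>C x"
    and scaleC_scaleC: "c *\<^sub>C (d *\<^sub>C x) = (c * d) *\<^sub>C x"
    and scaleC_one: "1 *\<^sub>C x = x"
    and scaleC_of_real: "complex_of_real r *\<^sub>C x = scaleR r x"
    and cinner_commute: "cinner x y = cnj (cinner y x)"
    and cinner_add_left: "cinner (x + y) z = cinner x z + cinner y z"
    and cinner_scaleC_left: "cinner (c *\<^sub>C x) y = c * cinner x y"
    and Re_cinner: "Re (cinner x y) = inner x y"

lemma cinner_self: "cinner x x = complex_of_real (inner x x)"
proof -
  have "Im (cinner x x) = Im (cnj (cinner x x))"
    using cinner_commute [of x x] by (rule arg_cong)
  then show ?thesis
    by (simp add: complex_eq_iff Re_cinner)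
qed

lemma norm_eq_sqrt_cinner: "norm x = sqrt (Re (cinner x x))"
  by (simp add: Re_cinner norm_eq_sqrt_inner)

class complex_hilbert = complex_inner + complete_space

instantiation complex :: complex_hilbert
begin

definition scaleC_complex :: "complex \<Rightarrow> complex \<Rightarrow> complex" where
  "scaleC_complex c x = c * x"

definition cinner_complex :: "complex \<Rightarrow> complex \<Rightarrow> complex" where
  "cinner_complex x y = x * cnj y"

instance
  by standard
    (auto simp: scaleC_complex_def cinner_complex_def algebra_simps scaleR_conv_of_real
      inner_complex_def)

end

global_interpretation complex_vector: vector_space "scaleC :: complex \<Rightarrow> 'a \<Rightarrow> 'a::complex_inner"
  defines csubspace = complex_vector.subspace
    and cspan = complex_vector.span
  by unfold_locales
    (simp_all add: scaleC_add_right scaleC_add_left scaleC_scaleC scaleC_one)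

definition infinite_dimensional :: "'a::complex_inner set \<Rightarrow> bool" where
  "infinite_dimensional S \<longleftrightarrow> \<not> (\<exists>B. finite B \<and> cspan B = S)"

text \<open>\<open>S\<close> is meant to be a closed subspace here.\<close>

definition orthonormal_basis_of :: "'a::complex_inner set \<Rightarrow> 'a set \<Rightarrow> bool" where
  "orthonormal_basis_of B S \<longleftrightarrow>
     (\<forall>x\<in>B. \<forall>y\<in>B. cinner x y = (if x = y then 1 else 0)) \<and> closure (cspan B) = S"

text \<open>
  The Hilbert space dimension of a closed subspace: the cardinal number of an orthonormal basis,
  compared by means of \<^const>\<open>ordIso\<close>.  It is independent of the choice of the basis.
\<close>

definition hilbert_dim :: "'a::complex_hilbert set \<Rightarrow> 'a rel" where
  "hilbert_dim S = card_of (SOME B. orthonormal_basis_of B S)"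


section \<open>Operators\<close>

definition bounded_clinear :: "('a::complex_inner \<Rightarrow> 'b::complex_inner) \<Rightarrow> bool" where
  "bounded_clinear T \<longleftrightarrow> bounded_linear T \<and> (\<forall>c x. T (c *\<^sub>C x) = c *\<^sub>C T x)"

text \<open>
  For a bounded operator on a Hilbert space the adjoint exists by the Riesz representation theorem,
  and the defining property determines it uniquely.
\<close>

definition cadjoint :: "('a::complex_inner \<Rightarrow> 'b::complex_inner) \<Rightarrow> 'b \<Rightarrow> 'a" where
  "cadjoint T = (THE S. \<forall>x y. cinner (T x) y = cinner x (S y))"

definition null_space :: "('a::complex_inner \<Rightarrow> 'b::complex_inner) \<Rightarrow> 'a set" where
  "null_space T = {x. T x = 0}"

definition normal_operator :: "('a::complex_inner \<Rightarrow> 'a) \<Rightarrow> bool" where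
  "normal_operator T \<longleftrightarrow> T \<circ> cadjoint T = cadjoint T \<circ> T"

definition star_paranormal :: "('a::complex_inner \<Rightarrow> 'a) \<Rightarrow> bool" where
  "star_paranormal T \<longleftrightarrow> (\<forall>x. (norm (cadjoint T x))\<^sup>2 \<le> norm (T (T x)) * norm x)"

text \<open>The operator norm of the restriction of \<open>T\<close> to the subspace \<open>M\<close>.\<close>

definition onorm_on :: "'a::real_normed_vector set \<Rightarrow> ('a \<Rightarrow> 'b::real_normed_vector) \<Rightarrow> real" where
  "onorm_on M T = (SUP x\<in>M. norm (T x) / norm x)"

lemma onorm_on_UNIV: "onorm_on UNIV T = onorm T"
  by (simp add: onorm_on_def onorm_def)

definition norm_attaining_on :: "'a::real_normed_vector set \<Rightarrow> ('a \<Rightarrow> 'b::real_normed_vector) \<Rightarrow> bool" where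
  "norm_attaining_on M T \<longleftrightarrow> (\<exists>x\<in>M. x \<noteq> 0 \<and> norm (T x) = onorm_on M T * norm x)"

definition absolutely_norm_attaining :: "('a::complex_inner \<Rightarrow> 'b::complex_inner) \<Rightarrow> bool" where
  "absolutely_norm_attaining T \<longleftrightarrow>
     (\<forall>M. csubspace M \<and> closed M \<and> M \<noteq> {0} \<longrightarrow> norm_attaining_on M T)"

definition AN :: "('a::complex_hilbert \<Rightarrow> 'a) set" where
  "AN = {T. bounded_clinear T \<and> absolutely_norm_attaining T}"

end

theory Submission
  imports Defs "HOL-Computational_Algebra.Fundamental_Theorem_Algebra"
begin

text \<open>
  For a \<open>*\<close>-paranormal operator every eigenvector is also an eigenvector of the adjoint, so the
  orthogonal complement \<open>L\<close> of the set of eigenvectors reduces \<open>T\<close>, and it suffices to prove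
  \<open>T T\<^sup>* = T\<^sup>* T\<close> on \<open>L\<close>.  Let \<open>a\<close> be the norm of \<open>T\<close> on \<open>L\<close>.  The vectors of \<open>L\<close> at which \<open>a\<close> is
  attained form the kernel \<open>M\<close> of \<open>T\<^sup>* T - a^2\<close> on \<open>L\<close>, and \<open>*\<close>-paranormality makes \<open>M\<close> invariant
  under \<open>T\<close>.  Since \<open>L\<close> contains no eigenvector, \<open>M\<close> is infinite-dimensional; absolute norm
  attainment then forces both \<open>P = L \<inter> M\<^sup>\<bottom>\<close> and \<open>N(T)\<close> to be finite-dimensional.  As \<open>N(T)\<close> is
  contained in \<open>N(T\<^sup>*)\<close>, equality of dimensions gives \<open>N(T) = N(T\<^sup>*)\<close>, so \<open>T M + T P\<close> is dense in
  \<open>L\<close>.  Since \<open>T M\<close> is orthogonal to both \<open>P\<close> and \<open>T P\<close>, this gives \<open>P \<subseteq> T P\<close>, hence \<open>T P = P\<close> by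
  dimension, so \<open>P = 0\<close> because there are no eigenvectors.  Thus \<open>T\<^sup>* T = a^2\<close> on \<open>L\<close>, and
  injectivity of the adjoint there yields \<open>T T\<^sup>* = a^2\<close> as well.
\<close>

section \<open>Complex inner product spaces\<close>

lemma cinner_add_right: "cinner x (y + z) = cinner x y + cinner x z"
  by (metis cinner_add_left cinner_commute complex_cnj_add)

lemma cinner_scaleC_right: "cinner x (c *\<^sub>C y) = cnj c * cinner x y"
  by (metis cinner_scaleC_left cinner_commute complex_cnj_mult)

lemma cinner_zero_left [simp]: "cinner 0 x = 0"
  using cinner_add_left [of 0 0 x] by simp

lemma cinner_zero_right [simp]: "cinner x 0 = 0"
  using cinner_add_right [of x 0 0] by simp

lemma cinner_diff_left: "cinner (x - y) z = cinner x z - cinner y z"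
  using cinner_add_left [of "x - y" y z] by simp

lemma cinner_diff_right: "cinner x (y - z) = cinner x y - cinner x z"
  using cinner_add_right [of x "y - z" z] by simp

lemma cinner_scaleR_left: "cinner (r *\<^sub>R x) y = r *\<^sub>R cinner x y"
  by (simp add: cinner_scaleC_left scaleR_conv_of_real flip: scaleC_of_real)

lemma cinner_scaleR_right: "cinner x (r *\<^sub>R y) = r *\<^sub>R cinner x y"
  by (simp add: cinner_scaleC_right scaleR_conv_of_real flip: scaleC_of_real)

lemma cinner_self_norm: "cinner x x = complex_of_real ((norm x)\<^sup>2)"
  by (simp add: cinner_self power2_norm_eq_inner)

lemma cinner_self_eq_zero_iff [simp]: "cinner x x = 0 \<longleftrightarrow> x = 0"
  by (simp add: cinner_self)

lemma cinner_eq_zero_commute: "cinner x y = 0 \<longleftrightarrow> cinner y x = 0"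
  by (metis cinner_commute complex_cnj_zero)

lemma norm_scaleC: "norm (c *\<^sub>C x) = cmod c * norm x"
proof -
  have "(norm (c *\<^sub>C x))\<^sup>2 = Re (cinner (c *\<^sub>C x) (c *\<^sub>C x))"
    by (simp add: power2_norm_eq_inner Re_cinner)
  also have "\<dots> = Re (c * cnj c * cinner x x)"
    by (simp only: cinner_scaleC_left cinner_scaleC_right mult_ac)
  also have "\<dots> = (cmod c * norm x)\<^sup>2"
    by (simp add: cinner_self_norm complex_norm_square [symmetric] power_mult_distrib
        del: of_real_power flip: of_real_mult)
  finally show ?thesis
    by (simp add: power2_eq_iff_nonneg)
qed

text \<open>Multiplying \<open>x\<close> by a unimodular \<open>u\<close> rotates the inner product
  onto the nonnegative real axis, where the real Cauchy-Schwarz inequality applies.\<close>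

lemma complex_Cauchy_Schwarz: "cmod (cinner x y) \<le> norm x * norm y"
proof (cases "cinner x y = 0")
  case False
  define u where "u = cnj (sgn (cinner x y))"
  have "u * cinner x y = complex_of_real (cmod (cinner x y))"
    using complex_norm_square [of "cinner x y"] False
    by (simp add: u_def sgn_div_norm scaleR_conv_of_real power2_eq_square field_simps)
  then have "cmod (cinner x y) = Re (u * cinner x y)"
    by simp
  also have "\<dots> = inner (u *\<^sub>C x) y"
    by (simp add: cinner_scaleC_left flip: Re_cinner)
  also have "\<dots> \<le> norm (u *\<^sub>C x) * norm y"
    by (rule norm_cauchy_schwarz)
  also have "\<dots> = norm x * norm y"
    using False by (simp add: norm_scaleC u_def norm_sgn)
  finally show ?thesis .
qed simp

lemma bounded_linear_scaleC: "bounded_linear ((*\<^sub>C) c)"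
  by (rule bounded_linear_intro [of _ "cmod c"])
    (simp_all add: scaleC_add_right norm_scaleC scaleC_scaleC mult.commute
      flip: scaleC_of_real)

lemma bounded_linear_cinner_left: "bounded_linear (\<lambda>x. cinner x y)"
  by (rule bounded_linear_intro [of _ "norm y"])
    (simp_all add: cinner_add_left cinner_scaleR_left complex_Cauchy_Schwarz)

lemma bounded_linear_cinner_right: "bounded_linear (cinner x)"
  by (rule bounded_linear_intro [of _ "norm x"])
    (simp_all add: cinner_add_right cinner_scaleR_right complex_Cauchy_Schwarz
      mult.commute [of "norm _" "norm x"])

lemmas continuous_on_cinner_left [continuous_intros] =
  bounded_linear.continuous_on [OF bounded_linear_cinner_left]
lemmas continuous_on_cinner_right [continuous_intros] =
  bounded_linear.continuous_on [OF bounded_linear_cinner_right]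

lemma norm_add_orthogonal:
  assumes "cinner x y = 0"
  shows "(norm (x + y))\<^sup>2 = (norm x)\<^sup>2 + (norm y)\<^sup>2"
  using arg_cong [OF assms, of Re]
  by (simp add: Re_cinner power2_norm_eq_inner inner_add_left inner_add_right inner_commute)

lemma csubspace_closure:
  assumes "csubspace S"
  shows "csubspace (closure S)"
proof (rule complex_vector.subspaceI)
  show "0 \<in> closure S"
    using assms closure_subset complex_vector.subspace_0 by blast
next
  fix x y
  assume "x \<in> closure S" "y \<in> closure S"
  then obtain f g where "\<forall>n. f n \<in> S" "f \<longlonglongrightarrow> x" "\<forall>n. g n \<in> S" "g \<longlonglongrightarrow> y"
    unfolding closure_sequential by blast
  then show "x + y \<in> closure S"
    unfolding closure_sequential
    by (intro exI [of _ "\<lambda>n. f n + g n"])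
      (simp add: tendsto_add complex_vector.subspace_add [OF assms])
next
  fix c x
  assume "x \<in> closure S"
  then obtain f where "\<forall>n. f n \<in> S" "f \<longlonglongrightarrow> x"
    unfolding closure_sequential by blast
  then show "c *\<^sub>C x \<in> closure S"
    unfolding closure_sequential
    by (intro exI [of _ "\<lambda>n. c *\<^sub>C f n"])
      (simp add: bounded_linear.tendsto [OF bounded_linear_scaleC]
        complex_vector.subspace_scale [OF assms])
qed

section \<open>Orthogonal complements\<close>

definition orth_compl :: "'a::complex_inner set \<Rightarrow> 'a set" where
  "orth_compl A = {y. \<forall>x\<in>A. cinner x y = 0}"

lemma orth_compl_iff: "y \<in> orth_compl A \<longleftrightarrow> (\<forall>x\<in>A. cinner x y = 0)"
  by (simp add: orth_compl_def)

lemma csubspace_orth_compl: "csubspace (orth_compl A)"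
  by (rule complex_vector.subspaceI)
    (simp_all add: orth_compl_iff cinner_add_right cinner_scaleC_right)

lemma closed_orth_compl: "closed (orth_compl A)"
proof -
  have "orth_compl A = (\<Inter>x\<in>A. {y. cinner x y = 0})"
    by (auto simp: orth_compl_def)
  then show ?thesis
    by (auto intro!: closed_Collect_eq continuous_intros)
qed

lemma orth_compl_disjoint: "x \<in> A \<Longrightarrow> x \<in> orth_compl A \<Longrightarrow> x = 0"
  by (auto simp: orth_compl_iff)

lemma orth_compl_cspan: "orth_compl (cspan A) = orth_compl A"
proof -
  have "cspan A \<subseteq> {x. cinner x y = 0}" if "y \<in> orth_compl A" for y
    using that
    by (intro complex_vector.span_minimal complex_vector.subspaceI)
      (auto simp: orth_compl_iff cinner_add_left cinner_scaleC_left)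
  then show ?thesis
    using complex_vector.span_superset [of A] by (fastforce simp: orth_compl_iff)
qed

lemma orth_compl_closure: "orth_compl (closure A) = orth_compl A"
proof -
  have "closure A \<subseteq> {x. cinner x y = 0}" if "y \<in> orth_compl A" for y
    using that
    by (intro closure_minimal closed_Collect_eq continuous_intros) (auto simp: orth_compl_iff)
  then show ?thesis
    using closure_subset [of A] by (fastforce simp: orth_compl_iff)
qed

section \<open>The projection theorem and the adjoint\<close>

text \<open>A sequence in \<open>S\<close> minimising the distance to \<open>x\<close> is Cauchy by
  the parallelogram law; its limit \<open>p\<close> is a nearest point, and minimality along each
  line through \<open>p\<close> in \<open>S\<close> is the orthogonality.\<close>

theorem orthogonal_projection_exists:
  fixes S :: "'a::{real_inner,complete_space} set"
  assumes "subspace S" "closed S"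
  shows "\<exists>p\<in>S. \<forall>y\<in>S. inner (x - p) y = 0"
proof -
  define d where "d = (INF y\<in>S. (norm (x - y))\<^sup>2)"
  have bdd: "bdd_below ((\<lambda>y. (norm (x - y))\<^sup>2) ` S)"
    by (rule bdd_belowI [of _ 0]) auto
  have d_le: "d \<le> (norm (x - y))\<^sup>2" if "y \<in> S" for y
    unfolding d_def using that by (intro cINF_lower bdd)
  have "0 \<in> S"
    using assms subspace_0 by blast
  have "\<exists>y\<in>S. (norm (x - y))\<^sup>2 < d + inverse (real (Suc n))" for n
    using cINF_less_iff [OF _ bdd, of "d + inverse (real (Suc n))"] \<open>0 \<in> S\<close>
    unfolding d_def by fastforce
  then obtain y where yS: "\<And>n. y n \<in> S"
    and y: "\<And>n. (norm (x - y n))\<^sup>2 < d + inverse (real (Suc n))"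
    by metis
  \<comment> \<open>Parallelogram identity for \<open>x - y m\<close> and \<open>x - y n\<close>:
    the midpoint lies in \<open>S\<close>, so its squared distance from \<open>x\<close> is at least
    \<open>d\<close>.\<close>
  have mid: "(norm (y m - y n))\<^sup>2 < 2 * inverse (real (Suc m)) + 2 * inverse (real (Suc n))" for m n
  proof -
    have "(1/2) *\<^sub>R (y m + y n) \<in> S"
      using assms yS by (simp add: subspace_add subspace_scale)
    from d_le [OF this]
    have "4 * d \<le> 4 * (norm (x - (1/2) *\<^sub>R (y m + y n)))\<^sup>2"
      by simp
    also have "\<dots> + (norm (y m - y n))\<^sup>2 = 2 * (norm (x - y m))\<^sup>2 + 2 * (norm (x - y n))\<^sup>2"
      unfolding power2_norm_eq_inner
      by (simp add: inner_diff_left inner_diff_right inner_add_left inner_add_right inner_commute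
          algebra_simps)
    finally show ?thesis
      using y [of m] y [of n] by linarith
  qed
  have "Cauchy y"
  proof (rule CauchyI)
    fix e :: real
    assume "0 < e"
    then obtain N where N: "inverse (real (Suc N)) < e\<^sup>2 / 4"
      using reals_Archimedean [of "e\<^sup>2 / 4"] by auto
    have "norm (y m - y n) < e" if "m \<ge> N" "n \<ge> N" for m n
    proof -
      have "inverse (real (Suc m)) \<le> inverse (real (Suc N))"
        "inverse (real (Suc n)) \<le> inverse (real (Suc N))"
        using that by auto
      then have "(norm (y m - y n))\<^sup>2 < e\<^sup>2"
        using mid [of m n] N by linarith
      then show ?thesis
        using \<open>0 < e\<close> by (simp add: power2_less_imp_less)
    qed
    then show "\<exists>M. \<forall>m\<ge>M. \<forall>n\<ge>M. norm (y m - y n) < e"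
      by blast
  qed
  then obtain p where p: "y \<longlonglongrightarrow> p"
    using Cauchy_convergent convergent_def by blast
  then have "p \<in> S"
    using \<open>closed S\<close> yS closed_sequentially by blast
  have "(\<lambda>n. (norm (x - y n))\<^sup>2) \<longlonglongrightarrow> (norm (x - p))\<^sup>2"
    by (intro tendsto_intros p)
  moreover have "(\<lambda>n. d + inverse (real (Suc n))) \<longlonglongrightarrow> d + 0"
    by (intro tendsto_intros LIMSEQ_inverse_real_of_nat)
  ultimately have le_d: "(norm (x - p))\<^sup>2 \<le> d + 0"
    using y by (intro LIMSEQ_le) (auto intro: less_imp_le)
  have "inner (x - p) z = 0" if "z \<in> S" for z
  proof (cases "z = 0")
    case False
    \<comment> \<open>This \<open>t\<close> minimises the squared distance from \<open>x\<close>
      along \<open>p + t *\<^sub>R z\<close>; the decrease it produces must be zero.\<close>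
    define t where "t = inner (x - p) z / (norm z)\<^sup>2"
    have "p + t *\<^sub>R z \<in> S"
      using \<open>p \<in> S\<close> that assms by (simp add: subspace_add subspace_scale)
    then have "(norm (x - p))\<^sup>2 \<le> (norm (x - (p + t *\<^sub>R z)))\<^sup>2"
      using d_le [of "p + t *\<^sub>R z"] le_d by linarith
    also have "\<dots> = (norm (x - p))\<^sup>2 - 2 * t * inner (x - p) z + t\<^sup>2 * (norm z)\<^sup>2"
      unfolding power2_norm_eq_inner
      by (simp add: inner_diff_left inner_diff_right inner_add_left inner_add_right inner_commute
          algebra_simps power2_eq_square)
    also have "\<dots> = (norm (x - p))\<^sup>2 - (inner (x - p) z)\<^sup>2 / (norm z)\<^sup>2"
      using False by (simp add: t_def power2_eq_square field_simps)
    finally show ?thesis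
      using False by (simp add: divide_le_0_iff)
  qed simp
  with \<open>p \<in> S\<close> show ?thesis
    by blast
qed

lemma csubspace_imp_subspace: "csubspace S \<Longrightarrow> subspace S"
  unfolding subspace_def complex_vector.subspace_def by (metis scaleC_of_real)

text \<open>The real projection suffices: as \<open>S\<close> is closed under multiplication by
  \<open>\<i>\<close>, real orthogonality to \<open>\<i> *\<^sub>C y\<close> removes the imaginary
  part of the inner product with \<open>y\<close>.\<close>

lemma complex_orthogonal_projection_exists:
  fixes S :: "'a::complex_hilbert set"
  assumes "csubspace S" "closed S"
  obtains p where "p \<in> S" "x - p \<in> orth_compl S"
proof -
  obtain p where p: "p \<in> S" "\<And>y. y \<in> S \<Longrightarrow> inner (x - p) y = 0"
    using orthogonal_projection_exists [OF csubspace_imp_subspace] assms by metis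
  have "cinner (x - p) y = 0" if "y \<in> S" for y
  proof -
    have "Im (cinner (x - p) y) = Re (cinner (x - p) (\<i> *\<^sub>C y))"
      by (simp add: cinner_scaleC_right)
    moreover have "\<i> *\<^sub>C y \<in> S"
      using that assms complex_vector.subspace_scale by blast
    ultimately show ?thesis
      using p that by (simp add: complex_eq_iff Re_cinner)
  qed
  with p(1) show thesis
    by (intro that) (auto simp: orth_compl_iff cinner_eq_zero_commute)
qed

lemma closed_csubspace_eqI:
  fixes S :: "'a::complex_hilbert set"
  assumes "csubspace S" "closed S" "csubspace W" "S \<subseteq> W" "W \<inter> orth_compl S \<subseteq> {0}"
  shows "S = W"
proof
  show "W \<subseteq> S"
  proof
    fix x
    assume "x \<in> W"
    obtain p where "p \<in> S" "x - p \<in> orth_compl S"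
      using complex_orthogonal_projection_exists assms by blast
    moreover have "x - p \<in> W"
      using \<open>p \<in> S\<close> \<open>x \<in> W\<close> assms complex_vector.subspace_diff by blast
    ultimately show "x \<in> S"
      using assms by fastforce
  qed
qed fact

section \<open>Bounded complex-linear operators\<close>

lemma bounded_clinear_scaleC: "bounded_clinear T \<Longrightarrow> T (c *\<^sub>C x) = c *\<^sub>C T x"
  by (simp add: bounded_clinear_def)

lemma bounded_clinear_bounded_linear: "bounded_clinear T \<Longrightarrow> bounded_linear T"
  by (simp add: bounded_clinear_def)

lemma bounded_clinear_add: "bounded_clinear T \<Longrightarrow> T (x + y) = T x + T y"
  by (simp add: bounded_clinear_def linear_add bounded_linear.linear)

lemma bounded_clinear_zero: "bounded_clinear T \<Longrightarrow> T 0 = 0"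
  by (simp add: bounded_clinear_def linear_0 bounded_linear.linear)

lemma bounded_clinear_diff: "bounded_clinear T \<Longrightarrow> T (x - y) = T x - T y"
  by (simp add: bounded_clinear_def linear_diff bounded_linear.linear)

lemma bounded_clinear_continuous_on:
  "bounded_clinear T \<Longrightarrow> continuous_on S f \<Longrightarrow> continuous_on S (\<lambda>x. T (f x))"
  by (simp add: bounded_clinear_def bounded_linear.continuous_on)

lemma bounded_clinear_module_hom: "bounded_clinear T \<Longrightarrow> module_hom (*\<^sub>C) (*\<^sub>C) T"
  by (simp add: module_hom_iff bounded_clinear_add bounded_clinear_scaleC
      complex_vector.module_axioms)

lemma cspan_image: "bounded_clinear T \<Longrightarrow> cspan (T ` B) = T ` cspan B"
  unfolding cspan_def by (rule module_hom.span_image [OF bounded_clinear_module_hom])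

text \<open>A vector \<open>w\<close> orthogonal to the kernel with \<open>f w \<noteq> 0\<close>
  determines \<open>f\<close>: the combination \<open>f w *\<^sub>C x - f x *\<^sub>C w\<close> is
  in the kernel, hence orthogonal to \<open>w\<close>, and this equation is solved for
  \<open>f x\<close>.\<close>

lemma riesz_representation:
  fixes f :: "'a::complex_hilbert \<Rightarrow> complex"
  assumes f: "bounded_clinear f"
  shows "\<exists>z. \<forall>x. f x = cinner x z"
proof (cases "\<forall>x. f x = 0")
  case True
  then show ?thesis
    by (intro exI [of _ 0]) simp
next
  case False
  then obtain v where v: "f v \<noteq> 0"
    by blast
  let ?N = "{x. f x = 0}"
  have N: "csubspace ?N"
    by (rule complex_vector.subspaceI)
      (simp_all add: bounded_clinear_add [OF f] bounded_clinear_scaleC [OF f]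
        bounded_clinear_zero [OF f] complex_vector.scale_zero_right)
  have "closed ?N"
    by (intro closed_Collect_eq bounded_clinear_continuous_on [OF f] continuous_intros)
  with N obtain p where p: "f p = 0" "v - p \<in> orth_compl ?N"
    using complex_orthogonal_projection_exists [of ?N v] by auto
  define w where "w = v - p"
  have fw: "f w \<noteq> 0"
    using v p by (simp add: w_def bounded_clinear_diff [OF f])
  then have "w \<noteq> 0"
    using bounded_clinear_zero [OF f] by metis
  have "f x = cinner x (cnj (f w / cinner w w) *\<^sub>C w)" for x
  proof -
    have "f (f w *\<^sub>C x - f x *\<^sub>C w) = 0"
      by (simp add: bounded_clinear_diff [OF f] bounded_clinear_scaleC [OF f] scaleC_complex_def)
    then have "cinner (f w *\<^sub>C x - f x *\<^sub>C w) w = 0"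
      using p(2) by (simp add: orth_compl_iff w_def)
    then show ?thesis
      using \<open>w \<noteq> 0\<close>
      by (simp add: cinner_diff_left cinner_scaleC_left cinner_scaleC_right field_simps)
  qed
  then show ?thesis
    by blast
qed

lemma bounded_clinear_cinner_left: "bounded_clinear (\<lambda>x. cinner x y)"
  by (simp add: bounded_clinear_def bounded_linear_cinner_left cinner_scaleC_left
      scaleC_complex_def)

lemma bounded_clinear_compose:
  "bounded_clinear f \<Longrightarrow> bounded_clinear g \<Longrightarrow> bounded_clinear (\<lambda>x. f (g x))"
  by (simp add: bounded_clinear_def bounded_linear_compose)

text \<open>Justifies the definite description in \<open>cadjoint\<close>: existence comes from
  Riesz representation for each fixed \<open>y\<close>, uniqueness from definiteness of the inner
  product.\<close>

lemma cinner_cadjoint: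
  fixes T :: "'a::complex_hilbert \<Rightarrow> 'b::complex_inner"
  assumes "bounded_clinear T"
  shows "cinner (T x) y = cinner x (cadjoint T y)"
proof -
  have "\<exists>z. \<forall>x. cinner (T x) y = cinner x z" for y
    by (rule riesz_representation [OF bounded_clinear_compose [OF bounded_clinear_cinner_left assms]])
  then obtain S where S: "\<forall>x y. cinner (T x) y = cinner x (S y)"
    by metis
  have "R = S" if R: "\<forall>x y. cinner (T x) y = cinner x (R y)" for R
  proof
    fix y
    have "cinner (R y - S y) (R y - S y) = 0"
      using R S by (simp add: cinner_diff_right)
    then show "R y = S y"
      by simp
  qed
  with S have "\<forall>x y. cinner (T x) y = cinner x (cadjoint T y)"
    unfolding cadjoint_def by (intro theI [of "\<lambda>S. \<forall>x y. cinner (T x) y = cinner x (S y)"]) auto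
  then show ?thesis
    by blast
qed

lemma cinner_cadjoint_left:
  fixes T :: "'a::complex_hilbert \<Rightarrow> 'b::complex_inner"
  assumes "bounded_clinear T"
  shows "cinner (cadjoint T y) x = cinner y (T x)"
  by (metis cinner_cadjoint [OF assms] cinner_commute)

lemma cinner_ext: "(\<And>z. cinner z x = cinner z y) \<Longrightarrow> x = y"
  by (metis cinner_diff_right cinner_self_eq_zero_iff eq_iff_diff_eq_0)

lemma bounded_clinear_cadjoint:
  fixes T :: "'a::complex_hilbert \<Rightarrow> 'b::complex_inner"
  assumes T: "bounded_clinear T"
  shows "bounded_clinear (cadjoint T)"
proof -
  have scale: "cadjoint T (c *\<^sub>C y) = c *\<^sub>C cadjoint T y" for c y
    by (rule cinner_ext) (simp add: cinner_scaleC_right flip: cinner_cadjoint [OF T])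
  obtain K where K: "\<And>x. norm (T x) \<le> norm x * K" "K > 0"
    using bounded_linear.pos_bounded [OF bounded_clinear_bounded_linear [OF T]] by blast
  have "bounded_linear (cadjoint T)"
  proof (rule bounded_linear_intro [of _ K])
    show "cadjoint T (x + y) = cadjoint T x + cadjoint T y" for x y
      by (rule cinner_ext) (simp add: cinner_add_right flip: cinner_cadjoint [OF T])
    show "cadjoint T (r *\<^sub>R x) = r *\<^sub>R cadjoint T x" for r x
      by (simp add: scale flip: scaleC_of_real)
    show "norm (cadjoint T y) \<le> norm y * K" for y
    proof -
      let ?z = "cadjoint T y"
      have "(norm ?z)\<^sup>2 = cmod (cinner ?z ?z)"
        by (simp add: cinner_self_norm del: of_real_power)
      also have "\<dots> = cmod (cinner (T ?z) y)"
        by (simp add: cinner_cadjoint [OF T])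
      also have "\<dots> \<le> norm (T ?z) * norm y"
        by (rule complex_Cauchy_Schwarz)
      also have "\<dots> \<le> norm ?z * K * norm y"
        by (intro mult_right_mono K) simp
      finally show ?thesis
        by (cases "?z = 0") (use \<open>K > 0\<close> in \<open>auto simp: power2_eq_square mult_ac\<close>)
    qed
  qed
  with scale show ?thesis
    by (simp add: bounded_clinear_def)
qed

section \<open>Finite-dimensional subspaces and orthonormal bases\<close>

text \<open>Gram-Schmidt by induction: \<open>d\<close> is the part of the new vector
  \<open>a\<close> orthogonal to \<open>B\<close>, and the residual \<open>x - p\<close> is
  corrected along \<open>d\<close>.\<close>

lemma finite_cspan_projection_exists:
  assumes "finite B"
  shows "\<exists>p\<in>cspan B. x - p \<in> orth_compl B"
  using assms
proof (induction B arbitrary: x)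
  case empty
  show ?case
    by (intro bexI [of _ 0]) (simp_all add: orth_compl_iff complex_vector.span_zero)
next
  case (insert a B)
  obtain p where p: "p \<in> cspan B" "x - p \<in> orth_compl B"
    using insert.IH by blast
  obtain q where q: "q \<in> cspan B" "a - q \<in> orth_compl B"
    using insert.IH by blast
  define d where "d = a - q"
  \<comment> \<open>If \<open>a\<close> already lies in the span, then \<open>d = 0\<close> and
    division by zero gives \<open>c = 0\<close>, which is the right coefficient.\<close>
  define c where "c = cinner (x - p) d / cinner d d"
  define r where "r = (x - p) - c *\<^sub>C d"
  have r: "r \<in> orth_compl B"
    unfolding r_def d_def using p q
    by (simp add: complex_vector.subspace_diff complex_vector.subspace_scale csubspace_orth_compl)
  then have "cinner q r = 0"
    using q(1) by (metis orth_compl_cspan orth_compl_iff)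
  moreover have "cinner r d = 0"
    by (simp add: r_def cinner_diff_left cinner_scaleC_left c_def)
  ultimately have "cinner a r = 0"
    using cinner_diff_left [of a q r] cinner_eq_zero_commute [of r d] by (simp add: d_def)
  with r have "x - (p + c *\<^sub>C d) \<in> orth_compl (insert a B)"
    by (simp add: orth_compl_iff r_def diff_diff_eq)
  moreover have "p + c *\<^sub>C d \<in> cspan (insert a B)"
    unfolding d_def using p(1) q(1) complex_vector.span_mono [of B "insert a B"]
    by (intro complex_vector.span_add complex_vector.span_scale complex_vector.span_diff)
      (auto intro: complex_vector.span_base)
  ultimately show ?case
    by blast
qed

text \<open>The residual of a limit point after projection lies both in the closure of the span and
  in its orthogonal complement, so it vanishes.\<close>

lemma closed_finite_cspan:
  assumes "finite B"
  shows "closed (cspan B)"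
proof -
  have "closure (cspan B) \<subseteq> cspan B"
  proof
    fix x
    assume x: "x \<in> closure (cspan B)"
    obtain p where p: "p \<in> cspan B" "x - p \<in> orth_compl B"
      using finite_cspan_projection_exists assms by blast
    have "x - p \<in> closure (cspan B)"
      using x p(1) closure_subset
      by (intro complex_vector.subspace_diff csubspace_closure complex_vector.subspace_span) auto
    then have "x - p = 0"
      using p(2) orth_compl_disjoint by (metis orth_compl_closure orth_compl_cspan)
    with p(1) show "x \<in> cspan B"
      by simp
  qed
  then show ?thesis
    using closure_subset_eq by blast
qed

lemma finite_dimensional_csubspace:
  assumes "\<not> infinite_dimensional S"
  shows "csubspace S"
  using assms unfolding infinite_dimensional_def by (metis complex_vector.subspace_span)

lemma finite_dimensional_closed:
  assumes "\<not> infinite_dimensional S"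
  shows "closed S"
  using assms closed_finite_cspan unfolding infinite_dimensional_def by metis

lemma finite_dimensional_basis:
  assumes "\<not> infinite_dimensional S"
  obtains B where "finite B" "complex_vector.independent B" "cspan B = S"
proof -
  obtain C where C: "finite C" "cspan C = S"
    using assms by (auto simp: infinite_dimensional_def)
  obtain B where "B \<subseteq> C" "complex_vector.independent B" "C \<subseteq> cspan B"
    by (rule complex_vector.maximal_independent_subset)
  moreover from this have "cspan B = cspan C"
    using complex_vector.span_superset [of C] by (simp add: complex_vector.span_eq)
  ultimately show thesis
    using C finite_subset by (intro that [of B]) auto
qed

lemma finite_dimensional_image:
  assumes "bounded_clinear T" "\<not> infinite_dimensional S"
  shows "\<not> infinite_dimensional (T ` S)"
  using assms unfolding infinite_dimensional_def by (metis cspan_image finite_imageI)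

lemma not_infinite_dimensional_zero: "\<not> infinite_dimensional {0}"
  unfolding infinite_dimensional_def by (metis complex_vector.span_empty finite.emptyI)

text \<open>An element of \<open>C\<close> outside \<open>cspan B\<close> would enlarge
  \<open>B\<close> to an independent subset of \<open>cspan C\<close> with more than
  \<open>card C\<close> elements.\<close>

lemma cspan_subset_if_independent_card_le:
  assumes "complex_vector.independent B" "finite C" "B \<subseteq> cspan C" "card C \<le> card B"
  shows "cspan C \<subseteq> cspan B"
proof -
  have B: "finite B"
    using complex_vector.independent_span_bound [OF assms(2,1,3)] by blast
  have "C \<subseteq> cspan B"
  proof
    fix c
    assume "c \<in> C"
    show "c \<in> cspan B"
    proof (rule ccontr)
      assume c: "c \<notin> cspan B"
      then have "complex_vector.independent (insert c B)"
        using assms(1) by (rule complex_vector.independent_insertI)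
      moreover have "insert c B \<subseteq> cspan C"
        using \<open>c \<in> C\<close> assms(3) by (simp add: complex_vector.span_base)
      ultimately have "card (insert c B) \<le> card C"
        using complex_vector.independent_span_bound [OF assms(2)] by blast
      moreover have "c \<notin> B"
        using c complex_vector.span_base by blast
      ultimately show False
        using B assms(4) by simp
    qed
  qed
  then show ?thesis
    by (simp add: complex_vector.span_minimal)
qed

lemma image_eq_if_subset_image:
  assumes "bounded_clinear T" "\<not> infinite_dimensional S" "S \<subseteq> T ` S"
  shows "T ` S = S"
proof -
  obtain B where B: "finite B" "complex_vector.independent B" "cspan B = S"
    using finite_dimensional_basis assms(2) by blast
  have "cspan (T ` B) \<subseteq> cspan B"
    using B assms complex_vector.span_superset [of B]
    by (intro cspan_subset_if_independent_card_le) (auto simp: cspan_image card_image_le)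
  with B assms show ?thesis
    by (auto simp: cspan_image)
qed

section \<open>Orthonormal bases and Hilbert dimension\<close>

definition orthonormal :: "'a::complex_inner set \<Rightarrow> bool" where
  "orthonormal B \<longleftrightarrow> (\<forall>x\<in>B. \<forall>y\<in>B. cinner x y = (if x = y then 1 else 0))"

lemma orthonormal_basis_of_iff:
  "orthonormal_basis_of B S \<longleftrightarrow> orthonormal B \<and> closure (cspan B) = S"
  by (simp add: orthonormal_basis_of_def orthonormal_def)

lemma orthonormal_independent:
  assumes "orthonormal B"
  shows "complex_vector.independent B"
  unfolding complex_vector.dependent_def
proof
  assume "\<exists>a\<in>B. a \<in> cspan (B - {a})"
  then obtain a where a: "a \<in> B" "a \<in> cspan (B - {a})"
    by blast
  have "a \<in> orth_compl (B - {a})"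
    using a(1) assms by (auto simp: orth_compl_iff orthonormal_def)
  then have "a = 0"
    using a(2) by (metis orth_compl_disjoint orth_compl_cspan)
  then show False
    using a(1) assms unfolding orthonormal_def by force
qed

text \<open>Zorn's lemma gives a maximal orthonormal subset of \<open>S\<close>; a nonzero vector of
  \<open>S\<close> orthogonal to its closed span could be normalised and added.\<close>

lemma orthonormal_basis_exists:
  fixes S :: "'a::complex_hilbert set"
  assumes "csubspace S" "closed S"
  shows "\<exists>B. orthonormal_basis_of B S"
proof -
  define F where "F = {B. orthonormal B \<and> B \<subseteq> S}"
  have "{} \<in> F"
    by (simp add: F_def orthonormal_def)
  have "\<Union>C \<in> F" if "subset.chain F C" for C
  proof -
    have "cinner x y = (if x = y then 1 else 0)" if "x \<in> \<Union>C" "y \<in> \<Union>C" for x y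
    proof -
      obtain X Y where "X \<in> C" "x \<in> X" "Y \<in> C" "y \<in> Y"
        using \<open>x \<in> \<Union>C\<close> \<open>y \<in> \<Union>C\<close> by blast
      moreover from this have "X \<subseteq> Y \<or> Y \<subseteq> X" "X \<in> F" "Y \<in> F"
        using \<open>subset.chain F C\<close> by (auto simp: subset_chain_def)
      ultimately show ?thesis
        by (auto simp: F_def orthonormal_def)
    qed
    then show ?thesis
      using that by (auto simp: F_def orthonormal_def subset_chain_def)
  qed
  then obtain B where B: "B \<in> F" and max: "\<And>X. X \<in> F \<Longrightarrow> B \<subseteq> X \<Longrightarrow> X = B"
    using subset_Zorn' [of F] by blast
  have "closure (cspan B) = S"
  proof (rule closed_csubspace_eqI)
    show "csubspace (closure (cspan B))" "closed (closure (cspan B))" "csubspace S"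
      by (simp_all add: assms csubspace_closure)
    have "cspan B \<subseteq> S"
      using B assms by (simp add: F_def complex_vector.span_minimal)
    then show "closure (cspan B) \<subseteq> S"
      using assms closure_minimal by blast
    show "S \<inter> orth_compl (closure (cspan B)) \<subseteq> {0}"
    proof
      fix x
      assume x: "x \<in> S \<inter> orth_compl (closure (cspan B))"
      then have xB: "x \<in> orth_compl B"
        by (simp add: orth_compl_closure orth_compl_cspan)
      show "x \<in> {0}"
      proof (rule ccontr)
        assume "x \<notin> {0}"
        define u where "u = (1 / norm x) *\<^sub>R x"
        have "cinner u u = 1"
          using \<open>x \<notin> {0}\<close> by (simp add: u_def cinner_self_norm)
        moreover have "cinner b u = 0" "cinner u b = 0" if "b \<in> B" for b
          using xB that cinner_eq_zero_commute [of b u]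
          by (auto simp: u_def orth_compl_iff cinner_scaleR_right)
        moreover have "u \<in> S"
          unfolding u_def using x csubspace_imp_subspace [OF assms(1)]
          by (simp add: subspace_scale)
        ultimately have "insert u B \<in> F"
          using B by (auto simp: F_def orthonormal_def)
        then have "u \<in> B"
          using max by blast
        then show False
          using \<open>\<And>b. b \<in> B \<Longrightarrow> cinner b u = 0\<close> \<open>cinner u u = 1\<close> by force
      qed
    qed
  qed
  with B show ?thesis
    by (auto simp: F_def orthonormal_basis_of_iff)
qed

lemma infinite_dimensional_orthonormal_sequence:
  fixes S :: "'a::complex_hilbert set"
  assumes "csubspace S" "closed S" "infinite_dimensional S"
  obtains e :: "nat \<Rightarrow> 'a"
  where "\<And>i. e i \<in> S" "\<And>i j. cinner (e i) (e j) = (if i = j then 1 else 0)"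
proof -
  obtain B where B: "orthonormal B" "closure (cspan B) = S"
    using orthonormal_basis_exists assms orthonormal_basis_of_iff by metis
  have "infinite B"
  proof
    assume "finite B"
    then have "cspan B = S"
      using B(2) closed_finite_cspan by (metis closure_closed)
    with \<open>finite B\<close> assms(3) show False
      by (auto simp: infinite_dimensional_def)
  qed
  then obtain e :: "nat \<Rightarrow> 'a" where e: "inj e" "range e \<subseteq> B"
    using infinite_countable_subset by blast
  show thesis
  proof (rule that [of e])
    show "e i \<in> S" for i
      using e(2) B(2) closure_subset [of "cspan B"] complex_vector.span_superset [of B] by auto
    show "cinner (e i) (e j) = (if i = j then 1 else 0)" for i j
    proof -
      have "e i \<in> B" "e j \<in> B"
        using e(2) by auto
      with B(1) show ?thesis
        using e(1) by (simp add: orthonormal_def inj_eq)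
    qed
  qed
qed

lemma hilbert_dim_some_basis:
  fixes S :: "'a::complex_hilbert set"
  assumes "csubspace S" "closed S"
  obtains B where "orthonormal_basis_of B S" "hilbert_dim S = card_of B"
  using someI_ex [OF orthonormal_basis_exists [OF assms]] by (simp add: hilbert_dim_def)

text \<open>Finite dimension of \<open>S\<close> makes its orthonormal basis finite, and equal
  dimension carries this to the basis of \<open>W\<close>; both closed spans are then plain spans,
  and counting independent vectors finishes.\<close>

lemma eq_if_hilbert_dim_eq:
  fixes S W :: "'a::complex_hilbert set"
  assumes S: "\<not> infinite_dimensional S"
    and W: "csubspace W" "closed W"
    and "S \<subseteq> W"
    and dim: "(hilbert_dim S, hilbert_dim W) \<in> ordIso"
  shows "S = W"
proof -
  obtain B where B: "orthonormal B" "closure (cspan B) = S" "hilbert_dim S = card_of B"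
    using hilbert_dim_some_basis finite_dimensional_csubspace finite_dimensional_closed S
      orthonormal_basis_of_iff by metis
  obtain C where C: "orthonormal C" "closure (cspan C) = W" "hilbert_dim W = card_of C"
    using hilbert_dim_some_basis W orthonormal_basis_of_iff by metis
  have BS: "B \<subseteq> S"
    using B(2) closure_subset complex_vector.span_superset by blast
  obtain D where D: "finite D" "cspan D = S"
    using S by (auto simp: infinite_dimensional_def)
  then have "finite B"
    using complex_vector.independent_span_bound orthonormal_independent B(1) BS by blast
  obtain f where f: "bij_betw f B C"
    using dim B(3) C(3) card_of_ordIso by metis
  then have "finite C" "card B = card C"
    using \<open>finite B\<close> bij_betw_finite bij_betw_same_card by blast+
  then have "cspan C = W"
    using C(2) closed_finite_cspan by (metis closure_closed)
  then have "cspan C \<subseteq> cspan B"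
    using \<open>finite C\<close> \<open>card B = card C\<close> BS \<open>S \<subseteq> W\<close> B(1)
    by (intro cspan_subset_if_independent_card_le orthonormal_independent) auto
  then have "W \<subseteq> S"
    using \<open>cspan C = W\<close> B(2) closure_subset [of "cspan B"] by blast
  with \<open>S \<subseteq> W\<close> show ?thesis
    by blast
qed

section \<open>Eigenvectors on finite-dimensional invariant subspaces\<close>

text \<open>The vector \<open>p(T) x\<close>, evaluated by Horner's scheme.\<close>

definition poly_apply :: "('a::complex_inner \<Rightarrow> 'a) \<Rightarrow> 'a \<Rightarrow> complex poly \<Rightarrow> 'a" where
  "poly_apply T x p = fold_coeffs (\<lambda>a v. a *\<^sub>C x + T v) p 0"

lemma poly_apply_0 [simp]: "poly_apply T x 0 = 0"
  by (simp add: poly_apply_def)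

lemma poly_apply_pCons:
  assumes "bounded_clinear T"
  shows "poly_apply T x (pCons a p) = a *\<^sub>C x + T (poly_apply T x p)"
  by (cases "p = 0 \<and> a = 0")
    (auto simp: poly_apply_def bounded_clinear_zero [OF assms] complex_vector.scale_zero_left)

lemma poly_apply_add:
  assumes "bounded_clinear T"
  shows "poly_apply T x (p + q) = poly_apply T x p + poly_apply T x q"
  by (induction p q rule: poly_induct2)
    (simp_all add: poly_apply_pCons [OF assms] bounded_clinear_add [OF assms] scaleC_add_left)

lemma poly_apply_smult:
  assumes "bounded_clinear T"
  shows "poly_apply T x (smult c p) = c *\<^sub>C poly_apply T x p"
  by (induction p)
    (simp_all add: poly_apply_pCons [OF assms] bounded_clinear_scaleC [OF assms]
      scaleC_add_right scaleC_scaleC)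

lemma poly_apply_monom:
  assumes "bounded_clinear T"
  shows "poly_apply T x (monom c n) = c *\<^sub>C (T ^^ n) x"
  by (induction n)
    (simp_all add: monom_0 monom_Suc poly_apply_pCons [OF assms] bounded_clinear_zero [OF assms]
      bounded_clinear_scaleC [OF assms])

lemma poly_apply_sum:
  assumes "bounded_clinear T"
  shows "poly_apply T x (\<Sum>i\<in>I. f i) = (\<Sum>i\<in>I. poly_apply T x (f i))"
  by (induction I rule: infinite_finite_induct) (simp_all add: poly_apply_add [OF assms])

lemma poly_apply_mem:
  assumes "bounded_clinear T" "csubspace S" "T ` S \<subseteq> S" "x \<in> S"
  shows "poly_apply T x p \<in> S"
  using assms
  by (induction p)
    (auto simp: poly_apply_pCons complex_vector.subspace_0
      intro!: complex_vector.subspace_add complex_vector.subspace_scale)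

text \<open>The orbit of \<open>x\<close> stays in \<open>S\<close>. Either two powers of
  \<open>T\<close> agree at \<open>x\<close>, or the orbit is an infinite, hence dependent, set;
  each case supplies the coefficients of a polynomial.\<close>

lemma annihilating_poly_exists:
  assumes T: "bounded_clinear T" and S: "\<not> infinite_dimensional S" "T ` S \<subseteq> S" "x \<in> S"
  shows "\<exists>p. p \<noteq> 0 \<and> poly_apply T x p = 0"
proof -
  have pow: "(T ^^ i) x \<in> S" for i
    using S by (induction i) auto
  show ?thesis
  proof (cases "inj (\<lambda>i. (T ^^ i) x)")
    case False
    then obtain i j where ij: "i \<noteq> j" "(T ^^ i) x = (T ^^ j) x"
      by (auto simp: inj_def)
    let ?p = "monom (1::complex) i + monom (-1) j"
    have "poly_apply T x ?p = (1 + (-1)) *\<^sub>C (T ^^ i) x"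
      unfolding scaleC_add_left using ij
      by (simp add: poly_apply_add [OF T] poly_apply_monom [OF T])
    moreover have "coeff ?p i = 1"
      using ij by simp
    then have "?p \<noteq> 0"
      by (metis coeff_0 zero_neq_one)
    ultimately show ?thesis
      by (intro exI [of _ ?p]) (simp add: complex_vector.scale_zero_left)
  next
    case True
    let ?A = "range (\<lambda>i. (T ^^ i) x)"
    have "complex_vector.dependent ?A"
    proof (rule ccontr)
      assume "complex_vector.independent ?A"
      moreover obtain B where "finite B" "cspan B = S"
        using S by (auto simp: infinite_dimensional_def)
      ultimately have "finite ?A"
        using complex_vector.independent_span_bound pow by blast
      with True show False
        by (simp add: finite_image_iff)
    qed
    then obtain t u where t: "finite t" "t \<subseteq> ?A" "(\<Sum>v\<in>t. u v *\<^sub>C v) = 0" "\<exists>v\<in>t. u v \<noteq> 0"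
      unfolding complex_vector.dependent_explicit by blast
    \<comment> \<open>Passing from vectors to exponents turns the linear relation into a polynomial;
      injectivity of the orbit keeps the coefficients from merging.\<close>
    obtain I where I: "t = (\<lambda>i. (T ^^ i) x) ` I"
      using t(2) by (auto simp: subset_image_iff)
    have inj: "inj_on (\<lambda>i. (T ^^ i) x) I"
      using True inj_on_subset by blast
    have "finite I"
      using t(1) I inj finite_image_iff by blast
    define p where "p = (\<Sum>i\<in>I. monom (u ((T ^^ i) x)) i)"
    have "poly_apply T x p = (\<Sum>i\<in>I. u ((T ^^ i) x) *\<^sub>C (T ^^ i) x)"
      by (simp add: p_def poly_apply_sum [OF T] poly_apply_monom [OF T])
    also have "\<dots> = 0"
      using t(3) by (simp add: I sum.reindex [OF inj])
    finally have "poly_apply T x p = 0" .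
    moreover have "p \<noteq> 0"
    proof -
      obtain k where k: "k \<in> I" "u ((T ^^ k) x) \<noteq> 0"
        using t(4) I by blast
      have "coeff p k = (\<Sum>i\<in>I. if k = i then u ((T ^^ i) x) else 0)"
        by (auto simp: p_def coeff_sum intro!: sum.cong)
      also have "\<dots> = u ((T ^^ k) x)"
        using k \<open>finite I\<close> by simp
      finally show ?thesis
        using k by auto
    qed
    ultimately show ?thesis
      by blast
  qed
qed

text \<open>Splitting a linear factor with root \<open>z\<close> off an annihilating polynomial of
  least degree leaves \<open>q\<close> with \<open>q(T) x \<noteq> 0\<close>, and this vector is an
  eigenvector for \<open>z\<close>.\<close>

lemma eigenvector_exists:
  assumes T: "bounded_clinear T" and S: "\<not> infinite_dimensional S" "T ` S \<subseteq> S" "S \<noteq> {0}"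
  shows "\<exists>x\<in>S. x \<noteq> 0 \<and> (\<exists>c. T x = c *\<^sub>C x)"
proof -
  have sub: "csubspace S"
    using S(1) by (rule finite_dimensional_csubspace)
  obtain x where x: "x \<in> S" "x \<noteq> 0"
    using S(3) sub complex_vector.subspace_0 by blast
  obtain p where p: "p \<noteq> 0" "poly_apply T x p = 0"
    and min: "\<And>q. q \<noteq> 0 \<Longrightarrow> poly_apply T x q = 0 \<Longrightarrow> degree p \<le> degree q"
    using annihilating_poly_exists [OF T S(1,2) x(1)]
      ex_has_least_nat [of "\<lambda>p. p \<noteq> 0 \<and> poly_apply T x p = 0" _ degree]
    by blast
  have "degree p \<noteq> 0"
  proof
    assume "degree p = 0"
    then obtain c where "p = [:c:]"
      by (rule degree_eq_zeroE)
    then show False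
      using p x(2)
      by (simp add: poly_apply_pCons [OF T] bounded_clinear_zero [OF T])
  qed
  then obtain z where "poly p z = 0"
    using fundamental_theorem_of_algebra constant_degree by metis
  then obtain q where q: "p = [:-z, 1:] * q"
    by (auto simp: poly_eq_0_iff_dvd)
  have "q \<noteq> 0"
    using p(1) q by auto
  then have "degree q < degree p"
    unfolding q by (subst degree_mult_eq) auto
  then have "poly_apply T x q \<noteq> 0"
    using min \<open>q \<noteq> 0\<close> by fastforce
  moreover have "poly_apply T x q \<in> S"
    by (rule poly_apply_mem [OF T sub S(2) x(1)])
  moreover have "0 = (- z) *\<^sub>C poly_apply T x q + T (poly_apply T x q)"
    using p(2) unfolding q mult_pCons_left
    by (simp add: poly_apply_add [OF T] poly_apply_smult [OF T] poly_apply_pCons [OF T]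
        del: smult_minus_left)
  then have "T (poly_apply T x q) = z *\<^sub>C poly_apply T x q"
    by (simp add: complex_vector.scale_minus_left)
  ultimately show ?thesis
    by blast
qed

section \<open>Absolutely norm attaining operators\<close>

text \<open>The real supremum dominates its members only when the quotients are bounded above, which
  boundedness of \<open>T\<close> supplies; at 0 the quotient is 0 by convention.\<close>

lemma norm_le_onorm_on:
  assumes "bounded_linear T" "x \<in> M"
  shows "norm (T x) \<le> onorm_on M T * norm x"
proof (cases "x = 0")
  case True
  then show ?thesis
    using assms(1) by (simp add: linear_0 bounded_linear.linear)
next
  case False
  obtain K where K: "\<And>x. norm (T x) \<le> norm x * K" "K > 0"
    using bounded_linear.pos_bounded [OF assms(1)] by blast
  have "norm (T x) / norm x \<le> K" for x
    using K by (cases "x = 0") (simp_all add: field_simps)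
  then have "bdd_above ((\<lambda>x. norm (T x) / norm x) ` M)"
    by (rule bdd_aboveI2)
  then have "norm (T x) / norm x \<le> onorm_on M T"
    unfolding onorm_on_def using assms(2) by (rule cSUP_upper2) simp
  with False show ?thesis
    by (simp add: field_simps)
qed

lemma absolutely_norm_attainingD:
  assumes "absolutely_norm_attaining T" "csubspace M" "closed M" "M \<noteq> {0}"
  obtains x where "x \<in> M" "x \<noteq> 0" "norm (T x) = onorm_on M T * norm x"
  using assms unfolding absolutely_norm_attaining_def norm_attaining_on_def by blast

text \<open>
  Tilting an orthonormal sequence of the first space by smaller and smaller multiples of one of the
  second space yields a subspace on which the supremum \<open>a\<close> is approached but never attained.
\<close>

lemma AN_orthogonal_finite_dimensional:
  fixes T :: "'a::complex_hilbert \<Rightarrow> 'b::complex_inner"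
  assumes T: "bounded_clinear T" and AN: "absolutely_norm_attaining T"
    and M: "csubspace M" "closed M" "infinite_dimensional M"
    and Q: "csubspace Q" "closed Q"
    and orth: "\<And>x y. x \<in> M \<Longrightarrow> y \<in> Q \<Longrightarrow> cinner x y = 0"
    and orthT: "\<And>x y. x \<in> M \<Longrightarrow> y \<in> Q \<Longrightarrow> cinner (T x) (T y) = 0"
    and normM: "\<And>x. x \<in> M \<Longrightarrow> norm (T x) = a * norm x"
    and normQ: "\<And>y. y \<in> Q \<Longrightarrow> norm (T y) \<le> b * norm y"
    and ab: "0 \<le> b" "b < a"
  shows "\<not> infinite_dimensional Q"
proof
  assume "infinite_dimensional Q"
  obtain e :: "nat \<Rightarrow> 'a" where e: "\<And>i. e i \<in> M"
    "\<And>i j. cinner (e i) (e j) = (if i = j then 1 else 0)"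
    by (rule infinite_dimensional_orthonormal_sequence [OF M]) blast
  obtain f :: "nat \<Rightarrow> 'a" where f: "\<And>i. f i \<in> Q"
    "\<And>i j. cinner (f i) (f j) = (if i = j then 1 else 0)"
    by (rule infinite_dimensional_orthonormal_sequence [OF Q \<open>infinite_dimensional Q\<close>]) blast
  have ef: "cinner (e i) (f j) = 0" "cinner (f j) (e i) = 0" for i j
    using orth e(1) f(1) cinner_eq_zero_commute by metis+
  have norm_e: "norm (e i) = 1" and norm_f: "norm (f i) = 1" for i
    by (simp_all add: norm_eq_sqrt_cinner e(2) f(2))
  \<comment> \<open>Both features of \<open>s\<close> matter: it tends to 0, so that
    \<open>a\<close> is approached along \<open>g\<close>, and it is never 0, so that orthogonality
    to \<open>f i\<close> can be passed on to \<open>g i\<close>.\<close>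
  define s where "s i = inverse (real (Suc i))" for i
  define g where "g i = e i + s i *\<^sub>R f i" for i
  define G where "G = closure (cspan (range g))"
  have g_f: "cinner (g i) (f j) = (if i = j then s i else 0)" for i j
    by (simp add: g_def cinner_add_left cinner_scaleR_left ef f scaleR_conv_of_real)
  have g_g: "cinner (g i) (g j) = (if i = j then 1 + (s i)\<^sup>2 else 0)" for i j
    unfolding g_def [of j] cinner_add_right cinner_scaleR_right g_f
    by (simp add: g_def cinner_add_left cinner_scaleR_left ef e scaleR_conv_of_real
        power2_eq_square)
  have gG: "g i \<in> G" for i
    unfolding G_def
    by (rule subsetD [OF closure_subset]) (simp add: complex_vector.span_base)
  have "g 0 \<noteq> 0"
    using g_g [of 0 0] by (intro notI) (simp add: s_def)
  then have G: "csubspace G" "closed G" "G \<noteq> {0}"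
    using gG [of 0] by (auto simp only: G_def csubspace_closure closed_closure
        complex_vector.subspace_span singleton_iff)
  \<comment> \<open>The relation holds on every \<open>g j\<close> and survives linear combinations
    and limits. Thus a vector of \<open>G\<close> orthogonal to \<open>f i\<close> is orthogonal to
    \<open>g i\<close>.\<close>
  have f_via_g: "(1 + (s i)\<^sup>2) *\<^sub>R cinner x (f i) = s i *\<^sub>R cinner x (g i)" if "x \<in> G" for x i
  proof -
    let ?Z = "{x. (1 + (s i)\<^sup>2) *\<^sub>R cinner x (f i) = s i *\<^sub>R cinner x (g i)}"
    have "csubspace ?Z"
      by (rule complex_vector.subspaceI)
        (simp_all add: cinner_add_left cinner_scaleC_left scaleR_add_right flip: mult_scaleR_right)
    moreover have "range g \<subseteq> ?Z"
      by (auto simp: g_f g_g scaleR_conv_of_real)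
    ultimately have "cspan (range g) \<subseteq> ?Z"
      by (intro complex_vector.span_minimal)
    then have "G \<subseteq> ?Z"
      unfolding G_def by (intro closure_minimal closed_Collect_eq continuous_intros)
    with that show ?thesis
      by blast
  qed
  \<comment> \<open>Every coordinate along some \<open>f i\<close> costs a definite amount below the
    bound \<open>a\<close>. The estimate is proved on sums from \<open>M\<close> and
    \<open>Q\<close>, and reaches \<open>G\<close> because it is a closed condition.\<close>
  have quad: "(norm (T x))\<^sup>2 + (a\<^sup>2 - b\<^sup>2) * (cmod (cinner x (f i)))\<^sup>2 \<le> a\<^sup>2 * (norm x)\<^sup>2"
    if "x \<in> G" for x i
  proof -
    let ?Z = "{x. (norm (T x))\<^sup>2 + (a\<^sup>2 - b\<^sup>2) * (cmod (cinner x (f i)))\<^sup>2 \<le> a\<^sup>2 * (norm x)\<^sup>2}"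
    have "cspan (range g) \<subseteq> {u + v | u v. u \<in> M \<and> v \<in> Q}"
      using e(1) f(1) csubspace_imp_subspace [OF Q(1)] unfolding g_def
      by (intro complex_vector.span_minimal complex_vector.subspace_sums M(1) Q(1))
        (auto intro!: subspace_scale)
    also have "\<dots> \<subseteq> ?Z"
    proof clarify
      fix u v
      assume uv: "u \<in> M" "v \<in> Q"
      have "(norm (T (u + v)))\<^sup>2 = (a * norm u)\<^sup>2 + (norm (T v))\<^sup>2"
        by (simp add: bounded_clinear_add [OF T] norm_add_orthogonal orthT uv flip: normM)
      also have "\<dots> \<le> (a * norm u)\<^sup>2 + (b * norm v)\<^sup>2"
        using normQ uv by (simp add: power_mono)
      finally have "(norm (T (u + v)))\<^sup>2 \<le> a\<^sup>2 * (norm u)\<^sup>2 + b\<^sup>2 * (norm v)\<^sup>2"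
        by (simp add: power_mult_distrib)
      moreover have "cmod (cinner (u + v) (f i)) \<le> norm v"
        using complex_Cauchy_Schwarz [of v "f i"] orth [OF uv(1) f(1)]
        by (simp add: cinner_add_left norm_f)
      then have "(a\<^sup>2 - b\<^sup>2) * (cmod (cinner (u + v) (f i)))\<^sup>2 \<le> (a\<^sup>2 - b\<^sup>2) * (norm v)\<^sup>2"
        using ab by (intro mult_left_mono power_mono) (auto intro: power_mono)
      moreover have "(norm (u + v))\<^sup>2 = (norm u)\<^sup>2 + (norm v)\<^sup>2"
        by (simp add: norm_add_orthogonal orth uv)
      ultimately show "(norm (T (u + v)))\<^sup>2 + (a\<^sup>2 - b\<^sup>2) * (cmod (cinner (u + v) (f i)))\<^sup>2
          \<le> a\<^sup>2 * (norm (u + v))\<^sup>2"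
        by (simp add: algebra_simps)
    qed
    finally have "G \<subseteq> ?Z"
      unfolding G_def
      by (intro closure_minimal closed_Collect_le continuous_intros
          bounded_clinear_continuous_on [OF T])
    with that show ?thesis
      by blast
  qed
  obtain x where x: "x \<in> G" "x \<noteq> 0" "norm (T x) = onorm_on G T * norm x"
    using absolutely_norm_attainingD AN G by blast
  \<comment> \<open>The vectors \<open>g i\<close> have images of norm at least \<open>a\<close>
    while their own norms tend to 1, so the supremum over \<open>G\<close> is at least
    \<open>a\<close>.\<close>
  have "a\<^sup>2 \<le> (onorm_on G T)\<^sup>2 * (1 + (s i)\<^sup>2)" for i
  proof -
    have "T (g i) = T (e i) + T (s i *\<^sub>R f i)"
      by (simp add: g_def bounded_clinear_add [OF T])
    moreover have "cinner (T (e i)) (T (s i *\<^sub>R f i)) = 0"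
      using e(1) f(1) csubspace_imp_subspace [OF Q(1)] by (intro orthT) (auto intro: subspace_scale)
    ultimately have "a\<^sup>2 \<le> (norm (T (g i)))\<^sup>2"
      by (simp add: norm_add_orthogonal normM e(1) norm_e)
    also have "\<dots> \<le> (onorm_on G T * norm (g i))\<^sup>2"
      using norm_le_onorm_on [OF bounded_clinear_bounded_linear [OF T] gG]
      by (intro power_mono) auto
    also have "(norm (g i))\<^sup>2 = 1 + (s i)\<^sup>2"
      using arg_cong [OF g_g [of i i], of Re] by (simp add: cinner_self_norm)
    then have "(onorm_on G T * norm (g i))\<^sup>2 = (onorm_on G T)\<^sup>2 * (1 + (s i)\<^sup>2)"
      by (simp add: power_mult_distrib)
    finally show ?thesis .
  qed
  moreover have "(\<lambda>i. (onorm_on G T)\<^sup>2 * (1 + (s i)\<^sup>2)) \<longlonglongrightarrow> (onorm_on G T)\<^sup>2 * (1 + 0\<^sup>2)"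
    unfolding s_def by (intro tendsto_intros LIMSEQ_inverse_real_of_nat)
  ultimately have "a\<^sup>2 \<le> (onorm_on G T)\<^sup>2 * (1 + 0\<^sup>2)"
    by (intro Lim_bounded2) auto
  then have Tx: "a\<^sup>2 * (norm x)\<^sup>2 \<le> (norm (T x))\<^sup>2"
    by (simp add: x(3) power_mult_distrib mult_right_mono)
  \<comment> \<open>At a vector attaining the supremum \<open>quad\<close> leaves no room for a
    coordinate along \<open>f i\<close>; hence \<open>x\<close> is orthogonal to all generators of
    \<open>G\<close>.\<close>
  have "cinner x (g i) = 0" for i
  proof -
    have "(a\<^sup>2 - b\<^sup>2) * (cmod (cinner x (f i)))\<^sup>2 \<le> 0"
      using quad [OF x(1), of i] Tx by linarith
    moreover have "a\<^sup>2 - b\<^sup>2 > 0"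
      using ab by (simp add: power_strict_mono)
    ultimately have "cinner x (f i) = 0"
      by (simp add: mult_le_0_iff)
    then show ?thesis
      using f_via_g [OF x(1), of i] by (simp add: s_def)
  qed
  then have "x \<in> orth_compl (range g)"
    using cinner_eq_zero_commute by (auto simp: orth_compl_iff)
  then have "x = 0"
    using x(1) unfolding G_def by (metis orth_compl_disjoint orth_compl_closure orth_compl_cspan)
  with x(2) show False
    by blast
qed

section \<open>Normality\<close>

lemma star_paranormalD: "star_paranormal T \<Longrightarrow> (norm (cadjoint T x))\<^sup>2 \<le> norm (T (T x)) * norm x"
  by (simp add: star_paranormal_def)

text \<open>At an eigenvector the defining inequality bounds the norm of \<open>cadjoint T x\<close>
  by \<open>cmod c * norm x\<close>, and the inner product with \<open>cnj c *\<^sub>C x\<close> is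
  already the square of that bound; expanding the squared distance of the two vectors gives at most
  0.\<close>

lemma star_paranormal_eigenvector:
  fixes T :: "'a::complex_hilbert \<Rightarrow> 'a"
  assumes T: "bounded_clinear T" "star_paranormal T" and x: "T x = c *\<^sub>C x"
  shows "cadjoint T x = cnj c *\<^sub>C x"
proof -
  let ?S = "cadjoint T"
  have "(norm (?S x))\<^sup>2 \<le> (cmod c * norm x)\<^sup>2"
    using star_paranormalD [OF T(2), of x] x
    by (simp add: bounded_clinear_scaleC [OF T(1)] norm_scaleC norm_mult power2_eq_square mult_ac)
  moreover have "Re (cinner (?S x) (cnj c *\<^sub>C x)) = (cmod c * norm x)\<^sup>2"
  proof -
    have "cinner (?S x) (cnj c *\<^sub>C x) = (c * cnj c) * cinner x x"
      by (simp add: cinner_scaleC_right cinner_cadjoint_left [OF T(1)] x)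
    also have "\<dots> = complex_of_real ((cmod c * norm x)\<^sup>2)"
      unfolding cinner_self_norm complex_norm_square [symmetric]
      by (simp add: power_mult_distrib)
    finally show ?thesis
      by simp
  qed
  moreover have "(norm (?S x - cnj c *\<^sub>C x))\<^sup>2 =
      (norm (?S x))\<^sup>2 - 2 * Re (cinner (?S x) (cnj c *\<^sub>C x)) + (norm (cnj c *\<^sub>C x))\<^sup>2"
    by (simp add: power2_norm_eq_inner Re_cinner inner_diff_left inner_diff_right inner_commute)
  ultimately have "(norm (?S x - cnj c *\<^sub>C x))\<^sup>2 \<le> 0"
    by (simp add: norm_scaleC)
  then show ?thesis
    by simp
qed

lemma star_paranormal_null_space:
  fixes T :: "'a::complex_hilbert \<Rightarrow> 'a"
  assumes "bounded_clinear T" "star_paranormal T"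
  shows "null_space T \<subseteq> null_space (cadjoint T)"
  using star_paranormal_eigenvector [OF assms, of _ 0]
  by (auto simp: null_space_def complex_vector.scale_zero_left)

lemma csubspace_null_space: "bounded_clinear T \<Longrightarrow> csubspace (null_space T)"
  by (rule complex_vector.subspaceI)
    (simp_all add: null_space_def bounded_clinear_add bounded_clinear_scaleC bounded_clinear_zero
      complex_vector.scale_zero_right)

lemma closed_null_space:
  assumes "bounded_clinear T"
  shows "closed (null_space T)"
  unfolding null_space_def
  by (intro closed_Collect_eq bounded_clinear_continuous_on [OF assms] continuous_intros)

text \<open>Transfers a bound known only on \<open>L\<close> to the adjoint: the usual duality
  estimate evaluates \<open>T\<close> solely at \<open>cadjoint T y\<close>.\<close>

lemma cadjoint_norm_le:
  fixes T :: "'a::complex_hilbert \<Rightarrow> 'a"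
  assumes T: "bounded_clinear T" and "0 \<le> a" and y: "cadjoint T y \<in> L"
    and bound: "\<And>z. z \<in> L \<Longrightarrow> norm (T z) \<le> a * norm z"
  shows "norm (cadjoint T y) \<le> a * norm y"
proof (cases "cadjoint T y = 0")
  case True
  then show ?thesis
    using \<open>0 \<le> a\<close> by simp
next
  case False
  let ?z = "cadjoint T y"
  have "(norm ?z)\<^sup>2 = cmod (cinner (T ?z) y)"
    by (simp add: cinner_cadjoint [OF T] cinner_self_norm del: of_real_power)
  also have "\<dots> \<le> norm (T ?z) * norm y"
    by (rule complex_Cauchy_Schwarz)
  also have "\<dots> \<le> a * norm ?z * norm y"
    by (intro mult_right_mono bound y) simp
  finally show ?thesis
    using False by (simp add: power2_eq_square mult_ac)
qed

text \<open>Equality case of Cauchy-Schwarz: \<open>cadjoint T (T x)\<close> has norm at most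
  \<open>a\<^sup>2 * norm x\<close>, yet its inner product with \<open>x\<close> equals
  \<open>a\<^sup>2 * (norm x)\<^sup>2\<close>.\<close>

lemma norm_attaining_eigenvector:
  fixes T :: "'a::complex_hilbert \<Rightarrow> 'a"
  assumes T: "bounded_clinear T" and "0 \<le> a" and L: "cadjoint T (T x) \<in> L"
    and bound: "\<And>z. z \<in> L \<Longrightarrow> norm (T z) \<le> a * norm z"
    and x: "norm (T x) = a * norm x"
  shows "cadjoint T (T x) = a\<^sup>2 *\<^sub>R x"
proof -
  let ?w = "cadjoint T (T x)"
  have "norm ?w \<le> a * (a * norm x)"
    using cadjoint_norm_le [OF T \<open>0 \<le> a\<close> L bound] x by simp
  then have "(norm ?w)\<^sup>2 \<le> (a\<^sup>2 * norm x)\<^sup>2"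
    by (intro power_mono) (simp_all add: power2_eq_square mult_ac)
  moreover have "inner ?w x = (a * norm x)\<^sup>2"
    by (simp add: cinner_cadjoint_left [OF T] cinner_self_norm x flip: Re_cinner)
  moreover have "(norm (?w - a\<^sup>2 *\<^sub>R x))\<^sup>2 = (norm ?w)\<^sup>2 - 2 * a\<^sup>2 * inner ?w x + (a\<^sup>2 * norm x)\<^sup>2"
    by (simp add: power2_norm_eq_inner inner_diff_left inner_diff_right inner_commute
        power_mult_distrib)
  moreover have "2 * a\<^sup>2 * (a * norm x)\<^sup>2 = 2 * (a\<^sup>2 * norm x)\<^sup>2"
    by (simp add: power2_eq_square)
  ultimately have "(norm (?w - a\<^sup>2 *\<^sub>R x))\<^sup>2 \<le> 0"
    by simp
  then show ?thesis
    by simp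
qed

text \<open>Isolates what is used of the orthogonal complement of the eigenvectors: \<open>L\<close>
  reduces \<open>T\<close>, contains no eigenvector and is orthogonal to the kernel.\<close>

lemma AN_star_paranormal_normal_off_eigenvectors:
  fixes T :: "'a::complex_hilbert \<Rightarrow> 'a"
  assumes T: "bounded_clinear T" and AN: "absolutely_norm_attaining T" and "star_paranormal T"
    and dim: "(hilbert_dim (null_space T), hilbert_dim (null_space (cadjoint T))) \<in> ordIso"
    and L: "csubspace L" "closed L"
    and TL: "\<And>x. x \<in> L \<Longrightarrow> T x \<in> L" and SL: "\<And>x. x \<in> L \<Longrightarrow> cadjoint T x \<in> L"
    and no_eigenvector: "\<And>x c. x \<in> L \<Longrightarrow> T x = c *\<^sub>C x \<Longrightarrow> x = 0"
    and null_L: "\<And>x y. x \<in> null_space T \<Longrightarrow> y \<in> L \<Longrightarrow> cinner x y = 0"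
    and "x \<in> L"
  shows "T (cadjoint T x) = cadjoint T (T x)"
proof (cases "L = {0}")
  case True
  with TL SL \<open>x \<in> L\<close> show ?thesis
    by (metis bounded_clinear_cadjoint [OF T] bounded_clinear_zero T singletonD)
next
  case False
  let ?S = "cadjoint T"
  note S = bounded_clinear_cadjoint [OF T]
  have no_fd_invariant: "V = {0}"
    if "\<not> infinite_dimensional V" "V \<subseteq> L" "T ` V \<subseteq> V" for V
    using eigenvector_exists [OF T, of V] no_eigenvector that by blast
  define a where "a = onorm_on L T"
  have bound: "norm (T z) \<le> a * norm z" if "z \<in> L" for z
    unfolding a_def using norm_le_onorm_on bounded_clinear_bounded_linear T that by blast
  obtain x0 where x0: "x0 \<in> L" "x0 \<noteq> 0" "norm (T x0) = a * norm x0"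
    unfolding a_def using absolutely_norm_attainingD AN L False by blast
  have inj: "T z \<noteq> 0" if "z \<in> L" "z \<noteq> 0" for z
    using no_eigenvector [of z 0] that by (auto simp: complex_vector.scale_zero_left)
  have "0 < a"
    using inj [OF x0(1,2)] x0(2,3) by (metis norm_ge_zero norm_le_zero_iff not_le mult_nonpos_nonneg)
  \<comment> \<open>Written as a kernel, \<open>M\<close> is visibly a closed subspace;
    \<open>M_iff\<close> identifies it with the vectors of \<open>L\<close> at which
    \<open>a\<close> is attained.\<close>
  define M where "M = {x \<in> L. ?S (T x) = a\<^sup>2 *\<^sub>R x}"
  have M_iff: "z \<in> M \<longleftrightarrow> norm (T z) = a * norm z" if "z \<in> L" for z
  proof
    assume "z \<in> M"
    then have "inner (T z) (T z) = inner z (a\<^sup>2 *\<^sub>R z)"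
      by (simp add: M_def cinner_cadjoint [OF T] flip: Re_cinner)
    then have "(norm (T z))\<^sup>2 = (a * norm z)\<^sup>2"
      by (simp add: power2_norm_eq_inner power_mult_distrib)
    then show "norm (T z) = a * norm z"
      using \<open>0 < a\<close> by (simp add: power2_eq_iff_nonneg)
  next
    assume "norm (T z) = a * norm z"
    then show "z \<in> M"
      using norm_attaining_eigenvector [OF T _ SL [OF TL [OF that]] bound] \<open>0 < a\<close> that
      by (simp add: M_def)
  qed
  have norm_M: "norm (T z) = a * norm z" if "z \<in> M" for z
    using that M_iff M_def by blast
  have M: "csubspace M" "closed M"
  proof -
    show "csubspace M"
      by (rule complex_vector.subspaceI)
        (auto simp: M_def L(1) complex_vector.subspace_0 complex_vector.subspace_add
          complex_vector.subspace_scale bounded_clinear_add [OF T] bounded_clinear_add [OF S]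
          bounded_clinear_scaleC [OF T] bounded_clinear_scaleC [OF S] bounded_clinear_zero [OF T]
          bounded_clinear_zero [OF S] scaleC_add_right scaleC_scaleC mult.commute
          simp flip: scaleC_of_real)
    have "M = L \<inter> {x. ?S (T x) = a\<^sup>2 *\<^sub>R x}"
      by (auto simp: M_def)
    then show "closed M"
      using L(2) by (auto intro!: closed_Collect_eq continuous_intros
          bounded_clinear_continuous_on [OF T] bounded_clinear_continuous_on [OF S])
  qed
  \<comment> \<open>Star-paranormality is applied at \<open>T z\<close>, where the adjoint also
    stretches by exactly \<open>a\<close>; this forces \<open>T (T z)\<close> to have norm at least
    \<open>a * norm (T z)\<close>.\<close>
  have TM: "T z \<in> M" if "z \<in> M" for z
  proof -
    have "z \<in> L" "?S (T z) = a\<^sup>2 *\<^sub>R z"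
      using that by (auto simp: M_def)
    have "norm (?S (T z)) = a * norm (T z)"
      using norm_M [OF that] \<open>?S (T z) = a\<^sup>2 *\<^sub>R z\<close> \<open>0 < a\<close> by (simp add: power2_eq_square)
    then have "(a * norm (T z))\<^sup>2 \<le> norm (T (T (T z))) * norm (T z)"
      using star_paranormalD [OF \<open>star_paranormal T\<close>, of "T z"] by simp
    also have "\<dots> \<le> a * norm (T (T z)) * norm (T z)"
      by (intro mult_right_mono bound TL \<open>z \<in> L\<close>) simp
    finally have "a * norm (T z) \<le> norm (T (T z))"
      using \<open>0 < a\<close> by (cases "T z = 0") (simp_all add: power2_eq_square)
    then show ?thesis
      using M_iff bound TL \<open>z \<in> L\<close> by (simp add: order_antisym)
  qed
  \<comment> \<open>\<open>M\<close> contains \<open>x0\<close> and is invariant, so finite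
    dimension would produce an eigenvector in \<open>L\<close>.\<close>
  have inf_M: "infinite_dimensional M"
    using no_fd_invariant [of M] TM x0 M_iff by (auto simp: M_def)
  define P where "P = L \<inter> orth_compl M"
  have P: "csubspace P" "closed P"
    unfolding P_def using L
    by (simp_all add: complex_vector.subspace_inter csubspace_orth_compl closed_orth_compl closed_Int)
  have MP: "cinner u v = 0" if "u \<in> M" "v \<in> P" for u v
    using that by (auto simp: P_def orth_compl_iff)
  have MP': "cinner (T u) (T v) = 0" if "u \<in> M" "cinner u v = 0" for u v
  proof -
    have "cinner (T u) (T v) = cinner (?S (T u)) v"
      by (simp add: cinner_cadjoint_left [OF T])
    with that show ?thesis
      by (simp add: M_def cinner_scaleR_left)
  qed
  \<comment> \<open>If \<open>P\<close> were infinite-dimensional, its supremum would be attained at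
    a vector outside \<open>M\<close> and so be strictly below \<open>a\<close>; it then serves as
    the bound \<open>b\<close> for \<open>P\<close> against \<open>M\<close>.\<close>
  have fin_P: "\<not> infinite_dimensional P"
  proof
    assume inf_P: "infinite_dimensional P"
    then have "P \<noteq> {0}"
      using not_infinite_dimensional_zero by metis
    then obtain z where z: "z \<in> P" "z \<noteq> 0" "norm (T z) = onorm_on P T * norm z"
      using absolutely_norm_attainingD AN P by blast
    have "z \<in> L" "z \<notin> M"
      using z orth_compl_disjoint by (auto simp: P_def)
    then have "norm (T z) < a * norm z"
      using M_iff bound by (metis order_le_less)
    then have "onorm_on P T < a"
      using z by simp
    moreover have "0 \<le> onorm_on P T"
      using z by (metis norm_ge_zero zero_le_mult_iff norm_le_zero_iff)
    ultimately show False
      using AN_orthogonal_finite_dimensional [OF T AN M inf_M P MP MP' norm_M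
          norm_le_onorm_on [OF bounded_clinear_bounded_linear [OF T]]] inf_P MP by blast
  qed
  \<comment> \<open>The kernel also qualifies as a partner of \<open>M\<close>: it is orthogonal to
    \<open>L\<close>, and \<open>T\<close> vanishes on it.\<close>
  have "\<not> infinite_dimensional (null_space T)"
  proof (rule AN_orthogonal_finite_dimensional [OF T AN M inf_M])
    show "csubspace (null_space T)" "closed (null_space T)"
      using T by (simp_all add: csubspace_null_space closed_null_space)
    show "cinner u v = 0" if "u \<in> M" "v \<in> null_space T" for u v
      using null_L [of v u] that by (simp add: M_def cinner_eq_zero_commute)
  qed (use \<open>0 < a\<close> norm_M in \<open>auto simp: null_space_def\<close>)
  then have null_S: "null_space T = null_space ?S"
    using S T \<open>star_paranormal T\<close> dim
    by (intro eq_if_hilbert_dim_eq star_paranormal_null_space csubspace_null_space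
        closed_null_space)
  have S_inj: "z = 0" if "z \<in> L" "?S z = 0" for z
    using that null_S inj by (auto simp: null_space_def set_eq_iff)
  \<comment> \<open>Density of \<open>T M + T P\<close> in \<open>L\<close>, in dual form: the
    adjoint sends such a \<open>w\<close> into \<open>P\<close> and also into the complement of
    \<open>P\<close>, hence to 0, and it is injective on \<open>L\<close>.\<close>
  have dense: "w = 0" if w: "w \<in> L" "w \<in> orth_compl (T ` M)" "w \<in> orth_compl (T ` P)" for w
  proof -
    have "?S w \<in> orth_compl M" "?S w \<in> orth_compl P"
      using w by (auto simp: orth_compl_iff simp flip: cinner_cadjoint [OF T])
    then have "?S w = 0"
      using w(1) SL by (intro orth_compl_disjoint [of _ P]) (auto simp: P_def)
    then show ?thesis
      using S_inj w(1) by blast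
  qed
  have "P \<subseteq> T ` P"
  proof
    fix p
    assume "p \<in> P"
    have TP: "csubspace (T ` P)" "closed (T ` P)"
      using finite_dimensional_image [OF T fin_P]
      by (simp_all add: finite_dimensional_csubspace finite_dimensional_closed)
    obtain q where q: "q \<in> T ` P" "p - q \<in> orth_compl (T ` P)"
      using complex_orthogonal_projection_exists [OF TP] by blast
    have "q \<in> orth_compl (T ` M)"
      using q(1) MP MP' by (auto simp: orth_compl_iff)
    moreover have "p \<in> orth_compl (T ` M)"
      using \<open>p \<in> P\<close> TM MP by (auto simp: orth_compl_iff)
    moreover have "p \<in> L" "q \<in> L"
      using \<open>p \<in> P\<close> q(1) TL by (auto simp: P_def)
    ultimately have "p - q = 0"
      using q(2) L(1) by (intro dense)
        (simp_all add: complex_vector.subspace_diff csubspace_orth_compl)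
    with q(1) show "p \<in> T ` P"
      by simp
  qed
  then have "T ` P = P"
    by (rule image_eq_if_subset_image [OF T fin_P])
  then have "P = {0}"
    using no_fd_invariant [of P] fin_P by (auto simp: P_def)
  then have "M = L"
    using M L(1) by (intro closed_csubspace_eqI) (auto simp: P_def M_def)
  then have ST: "?S (T z) = a\<^sup>2 *\<^sub>R z" if "z \<in> L" for z
    using that by (auto simp: M_def)
  \<comment> \<open>Applying \<open>ST\<close> at \<open>?S x\<close> gives the reversed identity
    after one more application of \<open>?S\<close>, which injectivity then cancels.\<close>
  have "?S (T (?S x) - a\<^sup>2 *\<^sub>R x) = 0"
    using ST [OF SL [OF \<open>x \<in> L\<close>]]
    by (simp add: bounded_clinear_diff [OF S] bounded_clinear_scaleC [OF S] flip: scaleC_of_real)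
  moreover have "T (?S x) - a\<^sup>2 *\<^sub>R x \<in> L"
    using \<open>x \<in> L\<close> TL SL csubspace_imp_subspace [OF L(1)]
    by (simp add: subspace_diff subspace_scale)
  ultimately have "T (?S x) - a\<^sup>2 *\<^sub>R x = 0"
    using S_inj by blast
  then show ?thesis
    using ST \<open>x \<in> L\<close> by simp
qed

theorem theorem3p15:
  fixes T :: "'a::complex_hilbert \<Rightarrow> 'a"
  assumes "infinite_dimensional (UNIV :: 'a set)"
    and "T \<in> AN"
    and "star_paranormal T"
    and "(hilbert_dim (null_space T), hilbert_dim (null_space (cadjoint T))) \<in> ordIso"
  shows "normal_operator T"
proof -
  let ?S = "cadjoint T"
  have T: "bounded_clinear T" and AN: "absolutely_norm_attaining T"
    using assms(2) by (auto simp: AN_def)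
  note S = bounded_clinear_cadjoint [OF T]
  define E where "E = {x. \<exists>c. T x = c *\<^sub>C x}"
  define L where "L = orth_compl E"
  \<comment> \<open>The commutation condition is linear and continuous, so \<open>K\<close> is a
    closed subspace, although \<open>E\<close> itself need not be a subspace.\<close>
  define K where "K = {x. T (?S x) = ?S (T x)}"
  have E: "\<exists>c. T x = c *\<^sub>C x \<and> ?S x = cnj c *\<^sub>C x" if "x \<in> E" for x
    using that star_paranormal_eigenvector [OF T assms(3)] by (auto simp: E_def)
  have TL: "T y \<in> L" if "y \<in> L" for y
    unfolding L_def orth_compl_iff
  proof
    fix x
    assume "x \<in> E"
    then obtain c where "?S x = cnj c *\<^sub>C x"
      using E by blast
    then show "cinner x (T y) = 0"
      using that \<open>x \<in> E\<close>
      by (simp add: L_def orth_compl_iff cinner_scaleC_left flip: cinner_cadjoint_left [OF T])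
  qed
  have SL: "?S y \<in> L" if "y \<in> L" for y
    unfolding L_def orth_compl_iff
  proof
    fix x
    assume "x \<in> E"
    then obtain c where "T x = c *\<^sub>C x"
      using E by blast
    then show "cinner x (?S y) = 0"
      using that \<open>x \<in> E\<close>
      by (simp add: L_def orth_compl_iff cinner_scaleC_left flip: cinner_cadjoint [OF T])
  qed
  have "L \<subseteq> K"
    unfolding K_def
  proof (intro subsetI CollectI AN_star_paranormal_normal_off_eigenvectors [OF T AN assms(3,4)])
    show "csubspace L" "closed L"
      by (simp_all add: L_def csubspace_orth_compl closed_orth_compl)
    show "x = 0" if "x \<in> L" "T x = c *\<^sub>C x" for x c
    proof -
      have "x \<in> E"
        using that(2) unfolding E_def by blast
      with that(1) show ?thesis
        unfolding L_def by (rule orth_compl_disjoint [rotated])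
    qed
    show "cinner x y = 0" if "x \<in> null_space T" "y \<in> L" for x y
    proof -
      have "x \<in> E"
        using that(1) unfolding E_def null_space_def
        by (auto intro!: exI [of _ 0] simp: complex_vector.scale_zero_left)
      with that(2) show ?thesis
        by (simp add: L_def orth_compl_iff)
    qed
  qed (auto simp: TL SL)
  have "E \<subseteq> K"
  proof
    fix x
    assume "x \<in> E"
    then obtain c where "T x = c *\<^sub>C x" "?S x = cnj c *\<^sub>C x"
      using E by blast
    then show "x \<in> K"
      by (simp add: K_def bounded_clinear_scaleC [OF T] bounded_clinear_scaleC [OF S]
          scaleC_scaleC mult.commute)
  qed
  \<comment> \<open>A vector orthogonal to \<open>K\<close> is orthogonal to \<open>E\<close>, hence
    lies in \<open>L\<close> and so in \<open>K\<close>, and is therefore 0.\<close>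
  have "K = UNIV"
  proof (rule closed_csubspace_eqI)
    show "csubspace K"
      by (rule complex_vector.subspaceI)
        (simp_all add: K_def bounded_clinear_add [OF T] bounded_clinear_add [OF S]
          bounded_clinear_scaleC [OF T] bounded_clinear_scaleC [OF S] bounded_clinear_zero [OF T]
          bounded_clinear_zero [OF S])
    show "closed K"
      unfolding K_def
      by (intro closed_Collect_eq continuous_intros bounded_clinear_continuous_on [OF T]
          bounded_clinear_continuous_on [OF S])
    show "UNIV \<inter> orth_compl K \<subseteq> {0}"
    proof
      fix x
      assume x: "x \<in> UNIV \<inter> orth_compl K"
      then have "x \<in> L"
        using \<open>E \<subseteq> K\<close> by (auto simp: L_def orth_compl_iff)
      then have "x \<in> K"
        using \<open>L \<subseteq> K\<close> by blast
      with x show "x \<in> {0}"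
        using orth_compl_disjoint by blast
    qed
  qed simp_all
  then show ?thesis
    by (auto simp: normal_operator_def fun_eq_iff K_def)
qed

end
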